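(* For any $m\ge2$, the algorithm ALG($1.75$) (the algorithm ALG($c$) of the context with $c=1.75$) is $1.75$-competitive and uses at most $2.5m$ job migrations on every job sequence.
   Context: Problem: jobs $J_1,\dots,J_n$ with processing times $p_i>0$ arrive online and must be assigned non-preemptively and immediately to one of $m$ identical machines $M_1,\dots,M_m$; a migration removes an assigned job and reassigns it. Makespan = maximum machine load in the final schedule; an algorithm is $c$-competitive if its makespan is at most $c$ times the optimum offline makespan on every sequence. Notation: $p_t^+=\sum_{i\le t}p_i$; $p_t^i$ = $i$-th largest processing time among $J_1,\dots,J_t$ ($0$ if $i>t$). $L_t=\max\{p_t^+/m,\ p_t^1,\ 2p_t^{m+1}\}$. Job $J_i$, $i\le t$, is small at time $t$ if $p_i\le(2c-3)L_t$; $J_t$ is small if small at time $t$, large otherwise. $\ell(j,t)$ = load of $M_j$ just before $J_t$ is assigned; $\ell_s(j,t)$ = same load counting only jobs small at time $t$. $A=\{M_1,\dots,M_{\lfloor m/2\rfloor}\}$, $B=\{M_{\lfloor m/2\rfloor+1},\dots,M_m\}$. Algorithm ALG($c$). Arrival phase: if $J_t$ is small, let $A'=\{M_j\in A:\ell_s(j,t)\le(c-1)L_t\}$; if $A'\ne\emptyset$ assign $J_t$ to a machine of $A'$ with smallest $\ell_s(j,t)$, otherwise to a least loaded machine of $B$. If $J_t$ is large: if some $M_j\in A$ has $\ell(j,t)\le(3-c)L_t$, assign $J_t$ to a least loaded machine of $A$, otherwise to a least loaded machine of $B$. Let $L=L_n$. Migration phase ($\ell(j)$ = current load): removal: $R=\emptyset$;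 from every machine of $B$ remove its largest job into $R$; while some $M_j\in A$ has $\ell(j)>(c-1)L$, remove its largest job into $R$. Reassignment: sort $R$ by non-increasing processing time; for each job $J$ in this order, if some $M_j\in B$ has $\ell(j)+p(J)\le cL$ assign $J$ there, otherwise to a least loaded machine of $A$. Each job of $R$ counts as one migration. *)

theory Defs
  imports Complex_Main
begin

text \<open>
  Jobs are numbered \<open>1, \<dots>, n\<close> and machines \<open>1, \<dots>, m\<close>. A job sequence is a pair of its length
  \<open>n\<close> and a function \<open>p\<close> whose values at \<open>1, \<dots>, n\<close> are the processing times; values elsewhere are
  irrelevant. A (partial) schedule maps each currently assigned job to its machine.
\<close>

type_synonym schedule = "nat \<Rightarrow> nat option"

definition jobs_on :: "schedule \<Rightarrow> nat \<Rightarrow> nat set" where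
  "jobs_on S j = {i. S i = Some j}"

definition load :: "(nat \<Rightarrow> real) \<Rightarrow> schedule \<Rightarrow> nat \<Rightarrow> real" where
  "load p S j = (\<Sum>i\<in>jobs_on S j. p i)"

definition makespan :: "nat \<Rightarrow> (nat \<Rightarrow> real) \<Rightarrow> schedule \<Rightarrow> real" where
  "makespan m p S = Max (load p S ` {1..m})"

definition schedules :: "nat \<Rightarrow> nat \<Rightarrow> schedule set" where
  "schedules m n = {S. dom S = {1..n} \<and> ran S \<subseteq> {1..m}}"

definition opt_makespan :: "nat \<Rightarrow> nat \<Rightarrow> (nat \<Rightarrow> real) \<Rightarrow> real" where
  "opt_makespan m n p = Min (makespan m p ` schedules m n)"

definition job_sequence :: "nat \<Rightarrow> (nat \<Rightarrow> real) \<Rightarrow> bool" where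
  "job_sequence n p \<longleftrightarrow> (\<forall>i\<in>{1..n}. 0 < p i)"

definition kth_largest :: "(nat \<Rightarrow> real) \<Rightarrow> nat \<Rightarrow> nat \<Rightarrow> real" where
  "kth_largest p t k =
     (if 1 \<le> k \<and> k \<le> t then rev (sort (map p [1..<Suc t])) ! (k - 1) else 0)"

definition L :: "nat \<Rightarrow> (nat \<Rightarrow> real) \<Rightarrow> nat \<Rightarrow> real" where
  "L m p t = Max {(\<Sum>i=1..t. p i) / real m, kth_largest p t 1, 2 * kth_largest p t (m + 1)}"

definition small_at :: "real \<Rightarrow> nat \<Rightarrow> (nat \<Rightarrow> real) \<Rightarrow> nat \<Rightarrow> nat \<Rightarrow> bool" where
  "small_at c m p t i \<longleftrightarrow> p i \<le> (2 * c - 3) * L m p t"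

definition small_load :: "real \<Rightarrow> nat \<Rightarrow> (nat \<Rightarrow> real) \<Rightarrow> nat \<Rightarrow> schedule \<Rightarrow> nat \<Rightarrow> real" where
  "small_load c m p t S j = (\<Sum>i\<in>{i \<in> jobs_on S j. small_at c m p t i}. p i)"

definition mach_A :: "nat \<Rightarrow> nat set" where
  "mach_A m = {1..m div 2}"

definition mach_B :: "nat \<Rightarrow> nat set" where
  "mach_B m = {m div 2 + 1..m}"

text \<open>
  The algorithm leaves ties open (``a least loaded machine'', ``its largest job'', ``some
  machine''). It is therefore modelled as a relation that admits every way of resolving them.
\<close>

definition least_loaded :: "(nat \<Rightarrow> real) \<Rightarrow> schedule \<Rightarrow> nat set \<Rightarrow> nat \<Rightarrow> bool" where
  "least_loaded p S X j \<longleftrightarrow> is_arg_min (load p S) (\<lambda>k. k \<in> X) j"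

definition largest_job_on :: "(nat \<Rightarrow> real) \<Rightarrow> schedule \<Rightarrow> nat \<Rightarrow> nat \<Rightarrow> bool" where
  "largest_job_on p S j i \<longleftrightarrow> is_arg_max p (\<lambda>k. k \<in> jobs_on S j) i"

text \<open>\<open>arrival_choice c m p t S j\<close>: given the schedule \<open>S\<close> of the first \<open>t - 1\<close> jobs, job \<open>t\<close>
  may be put on machine \<open>j\<close>.\<close>

definition arrival_choice ::
  "real \<Rightarrow> nat \<Rightarrow> (nat \<Rightarrow> real) \<Rightarrow> nat \<Rightarrow> schedule \<Rightarrow> nat \<Rightarrow> bool" where
  "arrival_choice c m p t S j \<longleftrightarrow>
     (if small_at c m p t t then
        (let A' = {k \<in> mach_A m. small_load c m p t S k \<le> (c - 1) * L m p t} in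
         if A' \<noteq> {} then is_arg_min (small_load c m p t S) (\<lambda>k. k \<in> A') j
         else least_loaded p S (mach_B m) j)
      else
        (if \<exists>k\<in>mach_A m. load p S k \<le> (3 - c) * L m p t then least_loaded p S (mach_A m) j
         else least_loaded p S (mach_B m) j))"

inductive arrival :: "real \<Rightarrow> nat \<Rightarrow> (nat \<Rightarrow> real) \<Rightarrow> nat \<Rightarrow> schedule \<Rightarrow> bool"
  for c :: real and m :: nat and p :: "nat \<Rightarrow> real" where
  arrival_0: "arrival c m p 0 Map.empty"
| arrival_Suc: "arrival c m p t S \<Longrightarrow> arrival_choice c m p (Suc t) S j \<Longrightarrow>
    arrival c m p (Suc t) (S(Suc t \<mapsto> j))"

text \<open>A machine of \<open>B\<close> without jobs contributes nothing to \<open>R\<close>.\<close>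

definition removal_B :: "nat \<Rightarrow> (nat \<Rightarrow> real) \<Rightarrow> schedule \<Rightarrow> schedule \<times> nat set \<Rightarrow> bool" where
  "removal_B m p S SR \<longleftrightarrow>
     (\<exists>r. (\<forall>j\<in>mach_B m. jobs_on S j \<noteq> {} \<longrightarrow> largest_job_on p S j (r j)) \<and>
          (let R = r ` {j \<in> mach_B m. jobs_on S j \<noteq> {}} in SR = (S |` (- R), R)))"

inductive removal_A ::
  "real \<Rightarrow> nat \<Rightarrow> (nat \<Rightarrow> real) \<Rightarrow> nat \<Rightarrow> schedule \<times> nat set \<Rightarrow> schedule \<times> nat set \<Rightarrow> bool"
  for c :: real and m :: nat and p :: "nat \<Rightarrow> real" and n :: nat where
  removal_A_done: "(\<forall>j\<in>mach_A m. load p S j \<le> (c - 1) * L m p n) \<Longrightarrow>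
    removal_A c m p n (S, R) (S, R)"
| removal_A_step: "j \<in> mach_A m \<Longrightarrow> load p S j > (c - 1) * L m p n \<Longrightarrow>
    largest_job_on p S j i \<Longrightarrow> removal_A c m p n (S(i := None), insert i R) SR' \<Longrightarrow>
    removal_A c m p n (S, R) SR'"

definition reassign_choice ::
  "real \<Rightarrow> nat \<Rightarrow> (nat \<Rightarrow> real) \<Rightarrow> nat \<Rightarrow> schedule \<Rightarrow> nat \<Rightarrow> nat \<Rightarrow> bool" where
  "reassign_choice c m p n S i j \<longleftrightarrow>
     (if \<exists>k\<in>mach_B m. load p S k + p i \<le> c * L m p n
      then j \<in> mach_B m \<and> load p S j + p i \<le> c * L m p n
      else least_loaded p S (mach_A m) j)"

inductive reassign ::
  "real \<Rightarrow> nat \<Rightarrow> (nat \<Rightarrow> real) \<Rightarrow> nat \<Rightarrow> schedule \<Rightarrow> nat list \<Rightarrow> schedule \<Rightarrow> bool"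
  for c :: real and m :: nat and p :: "nat \<Rightarrow> real" and n :: nat where
  reassign_Nil: "reassign c m p n S [] S"
| reassign_Cons: "reassign_choice c m p n S i j \<Longrightarrow> reassign c m p n (S(i \<mapsto> j)) is S' \<Longrightarrow>
    reassign c m p n S (i # is) S'"

text \<open>The possible outcomes on a job sequence: the final schedule together with the set \<open>R\<close> of
  migrated jobs.\<close>

definition ALG :: "real \<Rightarrow> nat \<Rightarrow> nat \<Rightarrow> (nat \<Rightarrow> real) \<Rightarrow> (schedule \<times> nat set) set" where
  "ALG c m n p = {(S, R). \<exists>S0 SR1 S2 is.
     arrival c m p n S0 \<and>
     removal_B m p S0 SR1 \<and>
     removal_A c m p n SR1 (S2, R) \<and>
     distinct is \<and> set is = R \<and> sorted_wrt (\<lambda>i k. p i \<ge> p k) is \<and>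
     reassign c m p n S2 is S}"

text \<open>Both notions below quantify over all outcomes of a nondeterministic algorithm on \<open>m\<close>
  machines. Competitiveness also requires that there is an outcome and that every outcome is a
  complete schedule, so that it cannot hold vacuously.\<close>

definition competitive ::
  "real \<Rightarrow> nat \<Rightarrow> (nat \<Rightarrow> (nat \<Rightarrow> real) \<Rightarrow> (schedule \<times> nat set) set) \<Rightarrow> bool" where
  "competitive c m alg \<longleftrightarrow>
     (\<forall>n p. job_sequence n p \<longrightarrow>
        alg n p \<noteq> {} \<and>
        (\<forall>(S, R)\<in>alg n p. S \<in> schedules m n \<and> makespan m p S \<le> c * opt_makespan m n p))"

definition migrations_at_most ::
  "real \<Rightarrow> (nat \<Rightarrow> (nat \<Rightarrow> real) \<Rightarrow> (schedule \<times> nat set) set) \<Rightarrow> bool" where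
  "migrations_at_most b alg \<longleftrightarrow>
     (\<forall>n p. job_sequence n p \<longrightarrow> (\<forall>(S, R)\<in>alg n p. finite R \<and> real (card R) \<le> b))"

end

theory Submission
  imports Defs
begin

text \<open>
  Since \<open>L\<close> bounds the optimum from below, it suffices that every final load is at most
  \<open>7/4 L\<close>. By averaging, a job goes to a machine of \<open>B\<close> only if that machine's load is at most
  \<open>3/4 L\<^sub>t\<close> (large job) or \<open>5/4 L\<^sub>t\<close> (small job), so removing one job leaves it at most \<open>5/4 L\<close>;
  a load above \<open>3/4 L\<close> then shows that all machines of \<open>A\<close> held many small jobs when the last job
  arrived. If a migrated job could be placed nowhere, the jobs would exceed the volume \<open>m L\<close>
  or more than \<open>m\<close> of them would exceed \<open>L / 2\<close>. On each machine of \<open>A\<close> at most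
  four removals suffice to bring the load down to \<open>3/4 L\<close>, which gives
  \<open>\<lceil>m/2\<rceil> + 4 \<lfloor>m/2\<rfloor> \<le> 5/2 m\<close> migrations.
\<close>

section \<open>Order statistics and the lower bound\<close>

text \<open>Passing to list positions keeps the multiplicity of equal processing times, which a set
  of values would lose.\<close>

lemma card_filter_job:
  "card {i \<in> {1..t}. P (p i)} = length (filter P (sort (map p [1..<Suc t])))"
proof -
  have "length (filter P (sort (map p [1..<Suc t]))) = length (filter (\<lambda>i. P (p i)) [1..<Suc t])"
    by (simp add: filter_sort filter_map o_def del: upt_Suc)
  also have "\<dots> = card (set (filter (\<lambda>i. P (p i)) [1..<Suc t]))"
    by (rule distinct_card[symmetric]) (simp del: upt_Suc)
  also have "set (filter (\<lambda>i. P (p i)) [1..<Suc t]) = {i \<in> {1..t}. P (p i)}"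
    by (auto simp del: upt_Suc)
  finally show ?thesis by simp
qed

text \<open>These two counts pin down the order statistic even with ties. In the ascending list
  \<open>xs\<close> the value sits at index \<open>t - k\<close>: the \<open>k\<close> entries from
  there on are at least as large, and larger ones occur only strictly after it.\<close>

lemma kth_largest_card:
  assumes "1 \<le> k" "k \<le> t"
  shows "k \<le> card {i \<in> {1..t}. kth_largest p t k \<le> p i}"
    and "card {i \<in> {1..t}. kth_largest p t k < p i} < k"
proof -
  define xs where "xs = sort (map p [1..<Suc t])"
  have len: "length xs = t" and srt: "sorted xs"
    unfolding xs_def by (simp_all del: upt_Suc)
  have v: "kth_largest p t k = xs ! (t - k)"
    using assms len unfolding kth_largest_def xs_def[symmetric] by (simp add: rev_nth)
  have "{t - k..<t} \<subseteq> {i. i < length xs \<and> xs ! (t - k) \<le> xs ! i}"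
  proof
    fix i assume i: "i \<in> {t - k..<t}"
    then have "xs ! (t - k) \<le> xs ! i" using srt len by (intro sorted_nth_mono) simp_all
    with i len show "i \<in> {i. i < length xs \<and> xs ! (t - k) \<le> xs ! i}" by simp
  qed
  from card_mono[OF _ this] have "k \<le> length (filter (\<lambda>x. xs ! (t - k) \<le> x) xs)"
    using assms by (simp add: length_filter_conv_card)
  then show "k \<le> card {i \<in> {1..t}. kth_largest p t k \<le> p i}"
    unfolding v card_filter_job[of t "\<lambda>x. xs ! (t - k) \<le> x" p] xs_def[symmetric] .
  have "{i. i < length xs \<and> xs ! (t - k) < xs ! i} \<subseteq> {t - k<..<t}"
  proof
    fix i assume i: "i \<in> {i. i < length xs \<and> xs ! (t - k) < xs ! i}"
    then have "\<not> i \<le> t - k"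
      using sorted_nth_mono[OF srt, of i "t - k"] len assms by auto
    with i len show "i \<in> {t - k<..<t}" by simp
  qed
  from card_mono[OF _ this] have "length (filter (\<lambda>x. xs ! (t - k) < x) xs) < k"
    using assms by (simp add: length_filter_conv_card)
  then show "card {i \<in> {1..t}. kth_largest p t k < p i} < k"
    unfolding v card_filter_job[of t "\<lambda>x. xs ! (t - k) < x" p] xs_def[symmetric] .
qed

lemma kth_largest_nonneg:
  assumes "\<forall>i\<in>{1..t}. 0 < p i"
  shows "0 \<le> kth_largest p t k"
proof (cases "1 \<le> k \<and> k \<le> t")
  case True
  then have "rev (sort (map p [1..<Suc t])) ! (k - 1) \<in> set (rev (sort (map p [1..<Suc t])))"
    by (intro nth_mem) (simp del: upt_Suc, linarith)
  then have "rev (sort (map p [1..<Suc t])) ! (k - 1) \<in> p ` {1..t}"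
    by (auto simp del: upt_Suc)
  with True assms show ?thesis unfolding kth_largest_def by force
qed (auto simp: kth_largest_def)

text \<open>A drop would put the at least \<open>k\<close> jobs counted at time \<open>s\<close>
  strictly above the value at time \<open>t\<close>, where fewer than \<open>k\<close> jobs lie. Out
  of range the old value is the default 0, and nonnegativity suffices.\<close>

lemma kth_largest_mono:
  assumes "s \<le> t" "\<forall>i\<in>{1..t}. 0 < p i"
  shows "kth_largest p s k \<le> kth_largest p t k"
proof (cases "1 \<le> k \<and> k \<le> s")
  case True
  show ?thesis
  proof (rule ccontr)
    assume "\<not> ?thesis"
    then have "{i \<in> {1..s}. kth_largest p s k \<le> p i} \<subseteq> {i \<in> {1..t}. kth_largest p t k < p i}"
      using assms(1) by auto
    from card_mono[OF _ this] have "k < k"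
      using kth_largest_card(1)[of k s p] kth_largest_card(2)[of k t p] True assms(1) by simp
    then show False by simp
  qed
next
  case False
  then have "kth_largest p s k = 0" by (auto simp: kth_largest_def)
  then show ?thesis using kth_largest_nonneg[OF assms(2)] by simp
qed

lemma L_ge:
  "(\<Sum>i=1..t. p i) / real m \<le> L m p t"
  "kth_largest p t 1 \<le> L m p t"
  "2 * kth_largest p t (m + 1) \<le> L m p t"
  by (simp_all add: L_def)

lemma L_mono:
  assumes "s \<le> t" "\<forall>i\<in>{1..t}. 0 < p i"
  shows "L m p s \<le> L m p t"
proof -
  have "(\<Sum>i=1..s. p i) \<le> (\<Sum>i=1..t. p i)"
    using assms by (intro sum_mono2) (auto intro: less_imp_le)
  then have "(\<Sum>i=1..s. p i) / real m \<le> (\<Sum>i=1..t. p i) / real m"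
    by (simp add: divide_right_mono)
  then have "(\<Sum>i=1..s. p i) / real m \<le> L m p t" using L_ge(1) order_trans by blast
  moreover have "kth_largest p s 1 \<le> L m p t"
    using kth_largest_mono[OF assms] L_ge(2) order_trans by blast
  moreover have "2 * kth_largest p s (m + 1) \<le> L m p t"
    using kth_largest_mono[OF assms, of "m + 1"] L_ge(3)[of p t m] by linarith
  ultimately show ?thesis unfolding L_def[of m p s] by simp
qed

lemma job_le_L:
  assumes "i \<in> {1..t}"
  shows "p i \<le> L m p t"
proof -
  have "card {j \<in> {1..t}. kth_largest p t 1 < p j} < 1"
    using assms by (intro kth_largest_card(2)) auto
  then have "{j \<in> {1..t}. kth_largest p t 1 < p j} = {}" by simp
  then show ?thesis using assms L_ge(2)[of p t m] by force
qed

text \<open>By the third term of \<open>L\<close>, every job counted exceeds the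
  \<open>(m + 1)\<close>-st largest one, and at most \<open>m\<close> jobs do. For
  \<open>t \<le> m\<close> there are at most \<open>m\<close> jobs anyway.\<close>

lemma card_large_le:
  "card {i \<in> {1..t}. L m p t / 2 < p i} \<le> m"
proof (cases "m + 1 \<le> t")
  case True
  have "{i \<in> {1..t}. L m p t / 2 < p i} \<subseteq> {i \<in> {1..t}. kth_largest p t (m + 1) < p i}"
    using L_ge(3)[of p t m] by auto
  from card_mono[OF _ this] show ?thesis
    using kth_largest_card(2)[of "m + 1" t p] True by simp
next
  case False
  have "card {i \<in> {1..t}. L m p t / 2 < p i} \<le> card {1..t}" by (intro card_mono) auto
  with False show ?thesis by simp
qed

section \<open>Loads of schedules and the comparison of \<open>L\<close> with the optimum\<close>

lemma jobs_on_disjoint: "j \<noteq> k \<Longrightarrow> jobs_on S j \<inter> jobs_on S k = {}"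
  by (auto simp: jobs_on_def)

lemma jobs_on_subset_dom: "jobs_on S j \<subseteq> dom S"
  by (auto simp: jobs_on_def)

lemma dom_eq_UN_jobs_on: "ran S \<subseteq> M \<Longrightarrow> dom S = (\<Union>j\<in>M. jobs_on S j)"
  by (auto simp: jobs_on_def ran_def)

lemma jobs_on_upd:
  assumes "i \<notin> dom S"
  shows "jobs_on (S(i \<mapsto> j)) k = (if k = j then insert i (jobs_on S k) else jobs_on S k)"
  using assms by (auto simp: jobs_on_def)

lemma sum_dom_eq_sum_load:
  assumes "ran S \<subseteq> M" "finite M" "finite (dom S)"
  shows "sum p (dom S) = (\<Sum>j\<in>M. load p S j)"
  unfolding dom_eq_UN_jobs_on[OF assms(1)] load_def
  using assms jobs_on_disjoint finite_subset[OF jobs_on_subset_dom assms(3)]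
  by (intro sum.UNION_disjoint) auto

lemma load_le_makespan: "j \<in> {1..m} \<Longrightarrow> load p S j \<le> makespan m p S"
  by (simp add: makespan_def)

text \<open>Each term of \<open>L\<close> has its own reason: averaging over the machines, the
  machine that carries a largest job, and the pigeonhole principle, by which two of the
  \<open>m + 1\<close> largest jobs share a machine.\<close>

lemma L_le_makespan:
  assumes pos: "\<forall>i\<in>{1..n}. 0 < p i" and m: "0 < m" and S: "S \<in> schedules m n"
  shows "L m p n \<le> makespan m p S"
proof -
  have dom: "dom S = {1..n}" and ran: "ran S \<subseteq> {1..m}" using S by (auto simp: schedules_def)
  have fin: "finite (jobs_on S j)" for j
    using finite_subset[OF jobs_on_subset_dom, of S j] dom by simp
  have pos': "0 < p i" if "i \<in> jobs_on S j" for i j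
    using pos dom jobs_on_subset_dom[of S j] that by blast
  have "(\<Sum>i=1..n. p i) = (\<Sum>j\<in>{1..m}. load p S j)"
    using sum_dom_eq_sum_load[OF ran] dom by simp
  also have "\<dots> \<le> (\<Sum>j\<in>{1..m}. makespan m p S)"
    by (intro sum_mono load_le_makespan)
  finally have "(\<Sum>i=1..n. p i) / real m \<le> makespan m p S"
    using m by (simp add: field_simps)
  moreover have nonneg: "0 \<le> makespan m p S"
  proof -
    have "0 \<le> load p S 1" unfolding load_def using pos' by (intro sum_nonneg) (auto intro: less_imp_le)
    also have "\<dots> \<le> makespan m p S" using m by (intro load_le_makespan) auto
    finally show ?thesis .
  qed
  moreover have mach: "\<exists>j\<in>{1..m}. i \<in> jobs_on S j" if "i \<in> {1..n}" for i
    using dom_eq_UN_jobs_on[OF ran] dom that by auto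
  have "kth_largest p n 1 \<le> makespan m p S"
  proof (cases "1 \<le> n")
    case True
    then have "{i \<in> {1..n}. kth_largest p n 1 \<le> p i} \<noteq> {}"
      using kth_largest_card(1)[of 1 n p] by (metis card.empty le_refl not_one_le_zero)
    then obtain i where i: "i \<in> {1..n}" "kth_largest p n 1 \<le> p i" by blast
    then obtain j where j: "j \<in> {1..m}" "i \<in> jobs_on S j" using mach by blast
    have "p i \<le> load p S j" unfolding load_def
      using j fin pos' by (intro member_le_sum) (auto intro: less_imp_le)
    with i load_le_makespan[OF j(1), of p S] show ?thesis by linarith
  qed (use nonneg in \<open>auto simp: kth_largest_def\<close>)
  moreover have "2 * kth_largest p n (m + 1) \<le> makespan m p S"
  proof (cases "m + 1 \<le> n")
    case True
    define T where "T = {i \<in> {1..n}. kth_largest p n (m + 1) \<le> p i}"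
    have T: "card T > m" using kth_largest_card(1)[of "m + 1" n p] True by (simp add: T_def)
    have "(\<lambda>i. the (S i)) ` T \<subseteq> {1..m}"
    proof
      fix j assume "j \<in> (\<lambda>i. the (S i)) ` T"
      then obtain i where "i \<in> {1..n}" "j = the (S i)" by (auto simp: T_def)
      with mach[of i] show "j \<in> {1..m}" by (auto simp: jobs_on_def)
    qed
    from card_mono[OF _ this] have "card ((\<lambda>i. the (S i)) ` T) \<le> m" by simp
    with T have "\<not> inj_on (\<lambda>i. the (S i)) T" by (intro pigeonhole) linarith
    then obtain i k where ik: "i \<in> T" "k \<in> T" "i \<noteq> k" "the (S i) = the (S k)"
      by (auto simp: inj_on_def)
    then obtain j where j: "j \<in> {1..m}" "i \<in> jobs_on S j" using mach[of i] unfolding T_def by blast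
    have k: "k \<in> jobs_on S j"
      using ik j mach[of k] unfolding T_def jobs_on_def by force
    have "sum p {i, k} \<le> load p S j" unfolding load_def
      using j k fin pos' by (intro sum_mono2) (auto intro: less_imp_le)
    with ik load_le_makespan[OF j(1), of p S] show ?thesis by (auto simp: T_def)
  qed (use nonneg in \<open>auto simp: kth_largest_def\<close>)
  ultimately show ?thesis by (simp add: L_def)
qed

lemma L_le_opt:
  assumes "\<forall>i\<in>{1..n}. 0 < p i" "0 < m"
  shows "L m p n \<le> opt_makespan m n p"
proof -
  have "finite (schedules m n)"
    unfolding schedules_def by (rule finite_set_of_finite_maps) auto
  \<comment> \<open>Putting all jobs on machine 1 shows that the minimum ranges over a nonempty
    set.\<close>
  moreover have "(\<lambda>i. if i \<in> {1..n} then Some 1 else None) \<in> schedules m n"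
    using assms(2) by (auto simp: schedules_def ran_def split: if_splits)
  ultimately have "opt_makespan m n p \<in> makespan m p ` schedules m n"
    unfolding opt_makespan_def by (intro Min_in finite_imageI) blast+
  then obtain S where "S \<in> schedules m n" "opt_makespan m n p = makespan m p S" by blast
  then show ?thesis using L_le_makespan[OF assms] by simp
qed

section \<open>Sets of jobs that become light after few removals\<close>

text \<open>Asking for an arbitrary removal set makes the property easy to maintain when jobs are
  added; \<open>trimmable_remove_largest\<close> connects it to the greedy removal of the
  algorithm.\<close>

definition trimmable :: "(nat \<Rightarrow> real) \<Rightarrow> nat set \<Rightarrow> nat \<Rightarrow> real \<Rightarrow> bool" where
  "trimmable p K k y \<longleftrightarrow> (\<exists>X\<subseteq>K. card X \<le> k \<and> sum p (K - X) \<le> y)"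

lemma trimmableI: "X \<subseteq> K \<Longrightarrow> card X \<le> k \<Longrightarrow> sum p (K - X) \<le> y \<Longrightarrow> trimmable p K k y"
  unfolding trimmable_def by blast

lemma trimmable_mono: "trimmable p K k x \<Longrightarrow> x \<le> y \<Longrightarrow> trimmable p K k y"
  unfolding trimmable_def by (meson order_trans)

lemma trimmable_insert:
  assumes "trimmable p K k y" "finite K" "t \<notin> K"
  shows "trimmable p (insert t K) (Suc k) y"
proof -
  obtain X where X: "X \<subseteq> K" "card X \<le> k" "sum p (K - X) \<le> y"
    using assms(1) unfolding trimmable_def by blast
  have "insert t K - insert t X = K - X" using assms(3) by auto
  then show ?thesis
    using X finite_subset[OF X(1) assms(2)]
    by (intro trimmableI[of "insert t X"]) (auto simp: card_insert_if)
qed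

text \<open>Exchange argument: an overloaded \<open>K\<close> has a nonempty removal set
  \<open>X\<close>. If \<open>i\<close> is not in \<open>X\<close>, it takes the place of some
  \<open>x\<close> in \<open>X\<close>; what remains gains \<open>p x\<close> and loses
  \<open>p i\<close>, which is no smaller.\<close>

lemma trimmable_remove_largest:
  assumes "trimmable p K k y" "finite K" "y < sum p K" "i \<in> K" "\<forall>j\<in>K. p j \<le> p i"
  shows "\<exists>k'. k = Suc k' \<and> trimmable p (K - {i}) k' y"
proof -
  obtain X where X: "X \<subseteq> K" "card X \<le> k" "sum p (K - X) \<le> y"
    using assms(1) unfolding trimmable_def by blast
  have finX: "finite X" using X(1) assms(2) finite_subset by blast
  have "X \<noteq> {}" using X(3) assms(3) by auto
  then obtain x where x: "x \<in> X" "i \<in> X \<longrightarrow> x = i" by blast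
  have "0 < card X" using finX \<open>X \<noteq> {}\<close> by (simp add: card_gt_0_iff)
  then obtain k' where k': "k = Suc k'" using X(2) by (cases k) auto
  have c: "card (X - {x}) \<le> k'" using X(2) k' x finX by simp
  have "sum p (K - {i} - (X - {x})) \<le> sum p (K - X)"
  proof (cases "i \<in> X")
    case True
    then have "K - {i} - (X - {x}) = K - X" using x by auto
    then show ?thesis by simp
  next
    case False
    have xi: "x \<in> K" "x \<noteq> i" using x X False by auto
    have "K - {i} - (X - {x}) = insert x (K - X - {i})" using xi x False by auto
    then have "sum p (K - {i} - (X - {x})) = p x + sum p (K - X - {i})"
      using assms(2) x by simp
    also have "\<dots> \<le> p i + sum p (K - X - {i})" using assms(5) xi by simp
    also have "\<dots> = sum p (K - X)"
      using sum.remove[of "K - X" i p] assms False by simp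
    finally show ?thesis .
  qed
  moreover have "X - {x} \<subseteq> K - {i}" using X x by auto
  ultimately show ?thesis using k' c X(3) by (auto intro!: trimmableI[of "X - {x}"])
qed

text \<open>
  \<open>K\<close> is the content of a machine of \<open>A\<close> and \<open>x\<close> the current value of \<open>L\<close>. The bound for four
  removals is the one that matters. When a large job arrives, one removal is spent on it, so
  three removals must suffice for the old content, whose load is at most \<open>5/4 x\<close>. The bounds for
  two and three removals are stated relative to the load of \<open>K\<close> since \<open>x\<close> may have grown a lot
  until then.
\<close>
definition inv_A :: "(nat \<Rightarrow> real) \<Rightarrow> real \<Rightarrow> nat set \<Rightarrow> bool" where
  "inv_A p x K \<longleftrightarrow> card {i \<in> K. x / 2 < p i} \<le> 3 \<and>
     trimmable p K 2 (max (3/4 * x) (3/4 * sum p K)) \<and>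
     trimmable p K 3 (max (3/4 * x) (3/5 * sum p K)) \<and>
     trimmable p K 4 (3/4 * x)"

lemma inv_A_empty: "0 \<le> x \<Longrightarrow> inv_A p x {}"
  by (auto simp: inv_A_def trimmable_def)

text \<open>As \<open>x\<close> grows, fewer jobs exceed \<open>x / 2\<close>, the bounds in
  \<open>x\<close> get weaker, and those relative to \<open>sum p K\<close> do not change.\<close>

lemma inv_A_mono:
  assumes "inv_A p x K" "finite K" "x \<le> y"
  shows "inv_A p y K"
proof -
  have "card {i \<in> K. y / 2 < p i} \<le> card {i \<in> K. x / 2 < p i}"
    using assms by (intro card_mono) auto
  moreover have "max (3/4 * x) z \<le> max (3/4 * y) z" "3/4 * x \<le> 3/4 * y" for z
    using assms(3) by auto
  ultimately show ?thesis
    using assms(1) unfolding inv_A_def by (meson order_trans trimmable_mono)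
qed

text \<open>Three old jobs above \<open>x / 2\<close> would exceed the load \<open>5/4 * x\<close>,
  so at most two exist. Removing \<open>t\<close> leaves \<open>sum p K\<close>, less than
  \<open>3 * p t\<close> and so at most 3/4 of the new load. Otherwise \<open>t\<close> is removed
  on top of an old removal set: 3/4 of the old load is at most 3/5 of the new one as
  \<open>sum p K \<le> 4 * p t\<close>, and 3/5 of \<open>5/4 * x\<close> is
  \<open>3/4 * x\<close>.\<close>

lemma inv_A_insert_large:
  assumes inv: "inv_A p x K" and fin: "finite K" and t: "t \<notin> K" "x / 2 < p t"
    and pos: "\<forall>i\<in>K. 0 < p i" and x: "0 < x" and le: "sum p K \<le> 5/4 * x"
  shows "inv_A p x (insert t K)"
proof -
  define V where "V = {i \<in> K. x / 2 < p i}"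
  have "card V * (x / 2) \<le> sum p V"
    using sum_bounded_below[of V "x / 2" p] by (auto simp: V_def)
  also have "\<dots> \<le> sum p K"
    using fin pos by (intro sum_mono2) (auto simp: V_def intro: less_imp_le)
  finally have "real (card V) * (x / 2) < 3 * (x / 2)" using le x by linarith
  then have "card V \<le> 2" using x by simp
  moreover have "{i \<in> insert t K. x / 2 < p i} = insert t V" using t by (auto simp: V_def)
  ultimately have "card {i \<in> insert t K. x / 2 < p i} \<le> 3"
    using fin by (simp add: card_insert_if V_def)
  moreover have tot: "sum p (insert t K) = p t + sum p K" using fin t by simp
  moreover have "trimmable p (insert t K) 2 (max (3/4 * x) (3/4 * sum p (insert t K)))"
    by (rule trimmableI[of "{t}"]) (use t le tot in \<open>auto simp: max_def\<close>)
  moreover have "trimmable p (insert t K) 3 (max (3/4 * x) (3/5 * sum p (insert t K)))"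
  proof -
    have "trimmable p K 2 (max (3/4 * x) (3/4 * sum p K))" using inv by (simp add: inv_A_def)
    from trimmable_insert[OF this fin t(1)]
    have "trimmable p (insert t K) 3 (max (3/4 * x) (3/4 * sum p K))" by simp
    then show ?thesis
      by (rule trimmable_mono) (use t le tot in \<open>auto simp: max_def\<close>)
  qed
  moreover have "trimmable p (insert t K) 4 (3/4 * x)"
  proof -
    have "trimmable p K 3 (max (3/4 * x) (3/5 * sum p K))" using inv by (simp add: inv_A_def)
    then have "trimmable p K 3 (3/4 * x)" by (rule trimmable_mono) (use le in auto)
    from trimmable_insert[OF this fin t(1)] show ?thesis by simp
  qed
  ultimately show ?thesis by (simp add: inv_A_def)
qed

text \<open>Removing \<open>t\<close> and all of \<open>V\<close> leaves only \<open>U\<close>,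
  which meets the absolute bound with at most four removals. If fewer removals are allowed than that
  takes, jobs of \<open>V\<close> alone are removed; they are so large that the relative bound
  holds.\<close>

lemma inv_A_insert_small:
  assumes inv: "inv_A p x K" and fin: "finite K" and t: "t \<notin> K" "0 < p t" "p t \<le> x / 2"
    and pos: "\<forall>i\<in>K. 0 < p i" and bnd: "\<forall>i\<in>K. p i \<le> x"
    and le: "sum p {i \<in> K. p i \<le> x / 2} \<le> 3/4 * x"
  shows "inv_A p x (insert t K)"
proof -
  define U where "U = {i \<in> K. p i \<le> x / 2}"
  define V where "V = {i \<in> K. x / 2 < p i}"
  have UV: "K = U \<union> V" "U \<inter> V = {}" "finite U" "finite V" "t \<notin> U" "t \<notin> V"
    using fin t by (auto simp: U_def V_def)
  have V: "card V \<le> 3" using inv by (simp add: inv_A_def V_def)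
  have U: "sum p U \<le> 3/4 * x" using le by (simp add: U_def)
  have U0: "0 \<le> sum p U" using pos by (intro sum_nonneg) (auto simp: U_def intro: less_imp_le)
  have x: "0 < x" using t by linarith
  have "{i \<in> insert t K. x / 2 < p i} = V" using t by (auto simp: V_def)
  moreover have tot: "sum p (insert t K) = p t + sum p U + sum p V"
    using UV by (simp add: sum.union_disjoint)
  have Vlow: "real (card W) * (x / 2) \<le> sum p W" if "W \<subseteq> V" for W
    using that by (intro sum_bounded_below) (auto simp: V_def)
  have withV: "sum p (insert t K - insert t V) \<le> 3/4 * x"
  proof -
    have "insert t K - insert t V = U" using UV by auto
    then show ?thesis using U by simp
  qed
  have "trimmable p (insert t K) 2 (max (3/4 * x) (3/4 * sum p (insert t K)))"
  proof (cases "card V \<le> 1")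
    case True
    then show ?thesis
      using withV UV by (intro trimmableI[of "insert t V"]) auto
  next
    case False
    then have "2 \<le> card V" by simp
    then obtain W where W: "W \<subseteq> V" "card W = 2" by (meson obtain_subset_with_card_n)
    have "card (V - W) \<le> 1" using W V UV by (simp add: card_Diff_subset finite_subset)
    then have "real (card (V - W)) * x \<le> 1 * x" using x by (intro mult_right_mono) auto
    moreover have "sum p (V - W) \<le> real (card (V - W)) * x"
      using bnd UV by (intro sum_bounded_above) auto
    ultimately have "sum p (V - W) \<le> x" by linarith
    moreover have split: "sum p V = sum p W + sum p (V - W)"
      using W UV by (metis add.commute sum.subset_diff)
    moreover have "sum p (insert t K - W) = sum p (insert t K) - sum p W"
      using W UV by (intro sum_diff) auto
    \<comment> \<open>The rest is at most \<open>x / 2 + 3/4 * x + x\<close>, hence at most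
      \<open>3 * sum p W\<close>, which makes it at most 3/4 of the total.\<close>
    moreover have "x \<le> sum p W" using Vlow[OF W(1)] W(2) by simp
    ultimately show ?thesis
      using W UV U U0 t tot by (intro trimmableI[of W]) (auto simp: max_def)
  qed
  moreover have "trimmable p (insert t K) 3 (max (3/4 * x) (3/5 * sum p (insert t K)))"
  proof (cases "card V \<le> 2")
    case True
    then show ?thesis
      using withV UV by (intro trimmableI[of "insert t V"]) auto
  next
    case False
    then have "card V = 3" using V by simp
    \<comment> \<open>The rest is at most \<open>5/4 * x\<close>, below
      \<open>3/2 * sum p V\<close>, so it is at most 3/5 of the total.\<close>
    then have "3/2 * x \<le> sum p V" using Vlow[of V] by simp
    moreover have "insert t K - V = insert t U" using UV by auto
    ultimately show ?thesis
      using V UV U U0 t tot by (intro trimmableI[of V]) (auto simp: max_def)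
  qed
  moreover have "trimmable p (insert t K) 4 (3/4 * x)"
    using withV UV V by (intro trimmableI[of "insert t V"]) auto
  ultimately show ?thesis using V by (simp add: inv_A_def)
qed


section \<open>The arrival phase\<close>

locale job_instance =
  fixes m n :: nat and p :: "nat \<Rightarrow> real"
  assumes two_machines: "2 \<le> m"
    and pos: "i \<in> {1..n} \<Longrightarrow> 0 < p i"
begin

abbreviation A :: "nat set" where "A \<equiv> mach_A m"
abbreviation B :: "nat set" where "B \<equiv> mach_B m"
abbreviation LB :: "nat \<Rightarrow> real" where "LB \<equiv> L m p"

text \<open>For \<open>c = 7/4\<close> the threshold \<open>(2 * c - 3) * L\<close> is
  \<open>L / 2\<close>. The value \<open>y\<close> is separate from the schedule because
  \<open>inv_B\<close> refers to thresholds of earlier times.\<close>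

definition light :: "real \<Rightarrow> schedule \<Rightarrow> nat \<Rightarrow> real" where
  "light y S j = sum p {i \<in> jobs_on S j. p i \<le> y / 2}"

lemma machines: "{1..m} = A \<union> B" "A \<inter> B = {}" "finite A" "finite B" "A \<noteq> {}" "B \<noteq> {}"
  using two_machines by (auto simp: mach_A_def mach_B_def)

lemma A_D: "j \<in> A \<Longrightarrow> j \<in> {1..m} \<and> j \<notin> B" and B_D: "j \<in> B \<Longrightarrow> j \<in> {1..m} \<and> j \<notin> A"
  using machines(1,2) by blast+

text \<open>Here \<open>e\<close> is the parity of \<open>m\<close>: \<open>B\<close> has one
  machine more than \<open>A\<close> when \<open>m\<close> is odd. Volume arguments pair each
  machine of \<open>A\<close> with one of \<open>B\<close> and treat the odd machine
  separately.\<close>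

lemma machine_counts:
  obtains k e :: real
  where "real (card A) = k" "real (card B) = k + e" "real m = 2 * k + e" "1 \<le> k" "e = 0 \<or> e = 1"
proof -
  obtain q r where "m = 2 * q + r" "r < 2"
    using that by (metis mod_less_divisor mult_div_mod_eq pos2)
  then have "card A = q" "card B = q + r" "1 \<le> q" "m = 2 * q + r" "r = 0 \<or> r = 1"
    using two_machines by (auto simp: mach_A_def mach_B_def)
  then show thesis using that[of "real q" "real r"] by auto
qed

lemma LB_mono: "s \<le> t \<Longrightarrow> t \<le> n \<Longrightarrow> LB s \<le> LB t"
  using pos by (intro L_mono) auto

lemma LB_pos: "1 \<le> t \<Longrightarrow> t \<le> n \<Longrightarrow> 0 < LB t"
  using job_le_L[of t t p m] pos[of t] by simp

lemma LB_nonneg: "0 \<le> LB n"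
  using L_ge(2)[of p n m] kth_largest_nonneg[of n p 1] pos by force

lemma sum_le_LB: "sum p {1..t} \<le> real m * LB t"
  using L_ge(1)[of p t m] two_machines by (simp add: field_simps)

lemma volume_le:
  assumes "ran S \<subseteq> {1..m}" "finite (dom S)"
    and "\<And>a. a \<in> A \<Longrightarrow> \<alpha> \<le> load p S a" "\<And>b. b \<in> B \<Longrightarrow> \<beta> \<le> load p S b"
  shows "real (card A) * \<alpha> + real (card B) * \<beta> \<le> sum p (dom S)"
proof -
  have "sum p (dom S) = (\<Sum>j\<in>A. load p S j) + (\<Sum>j\<in>B. load p S j)"
    using sum_dom_eq_sum_load[OF assms(1) _ assms(2)] machines by (simp add: sum.union_disjoint)
  moreover have "real (card A) * \<alpha> \<le> (\<Sum>j\<in>A. load p S j)"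
    using assms(3) by (rule sum_bounded_below)
  moreover have "real (card B) * \<beta> \<le> (\<Sum>j\<in>B. load p S j)"
    using assms(4) by (rule sum_bounded_below)
  ultimately show ?thesis by simp
qed

lemma finite_jobs_on: "dom S \<subseteq> {1..n} \<Longrightarrow> finite (jobs_on S j)"
  by (meson finite_atLeastAtMost finite_subset jobs_on_subset_dom)

lemma pos_jobs_on: "dom S \<subseteq> {1..n} \<Longrightarrow> i \<in> jobs_on S j \<Longrightarrow> 0 < p i"
  using jobs_on_subset_dom pos by blast

lemma light_mono:
  assumes "dom S' \<subseteq> {1..n}" "jobs_on S j \<subseteq> jobs_on S' j" "y \<le> z"
  shows "light y S j \<le> light z S' j"
  unfolding light_def using finite_jobs_on[OF assms(1)] pos_jobs_on[OF assms(1)] assms(2,3)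
  by (intro sum_mono2) (force intro: less_imp_le)+

lemma light_le_load: "dom S \<subseteq> {1..n} \<Longrightarrow> light y S j \<le> load p S j"
  unfolding light_def load_def using finite_jobs_on pos_jobs_on
  by (intro sum_mono2) (auto intro: less_imp_le)

lemma load_upd:
  assumes "dom S \<subseteq> {1..n}" "i \<notin> dom S"
  shows "load p (S(i \<mapsto> j)) k = (if k = j then p i + load p S k else load p S k)"
proof -
  have "i \<notin> jobs_on S k" using assms(2) by (auto simp: jobs_on_def)
  then show ?thesis
    unfolding load_def jobs_on_upd[OF assms(2)] using finite_jobs_on[OF assms(1)] by auto
qed

text \<open>Evaluates the thresholds at \<open>c = 7/4\<close>, where \<open>c - 1\<close> is 3/4
  and \<open>3 - c\<close> is 5/4. In the case \<open>large_A\<close> some machine of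
  \<open>A\<close> meets the bound, hence so does a least loaded one.\<close>

lemma arrival_choice_cases:
  assumes "arrival_choice 1.75 m p t S j"
  obtains
    (small_A) "p t \<le> LB t / 2" "j \<in> A" "light (LB t) S j \<le> 3/4 * LB t"
  | (small_B) "p t \<le> LB t / 2" "j \<in> B" "\<And>b. b \<in> B \<Longrightarrow> load p S j \<le> load p S b"
      "\<And>a. a \<in> A \<Longrightarrow> 3/4 * LB t < light (LB t) S a"
  | (large_A) "LB t / 2 < p t" "j \<in> A" "load p S j \<le> 5/4 * LB t"
  | (large_B) "LB t / 2 < p t" "j \<in> B" "\<And>b. b \<in> B \<Longrightarrow> load p S j \<le> load p S b"
      "\<And>a. a \<in> A \<Longrightarrow> 5/4 * LB t < load p S a"
proof -
  have small: "small_at 1.75 m p t i \<longleftrightarrow> p i \<le> LB t / 2" for i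
    by (simp add: small_at_def)
  have light: "small_load 1.75 m p t S a = light (LB t) S a" for a
    unfolding small_load_def light_def small ..
  define A' where "A' = {k \<in> A. light (LB t) S k \<le> 3/4 * LB t}"
  have choice: "if p t \<le> LB t / 2 then
      (if A' \<noteq> {} then is_arg_min (light (LB t) S) (\<lambda>k. k \<in> A') j else least_loaded p S B j)
    else (if \<exists>k\<in>A. load p S k \<le> 5/4 * LB t then least_loaded p S A j else least_loaded p S B j)"
    using assms unfolding arrival_choice_def small light Let_def A'_def[symmetric]
    by (simp add: light A'_def cong: if_cong)
  have least: "least_loaded p S X j \<longleftrightarrow> j \<in> X \<and> (\<forall>k\<in>X. load p S j \<le> load p S k)" for X
    by (auto simp: least_loaded_def is_arg_min_linorder)
  show ?thesis
  proof (cases "p t \<le> LB t / 2")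
    case True
    then show ?thesis
    proof (cases "A' = {}")
      case A': True
      then have "\<And>a. a \<in> A \<Longrightarrow> 3/4 * LB t < light (LB t) S a" unfolding A'_def by force
      then show ?thesis using True A' choice small_B by (auto simp: least)
    next
      case False
      then have "j \<in> A'" using True choice by (simp add: is_arg_min_def)
      then show ?thesis using True small_A by (simp add: A'_def)
    qed
  next
    case False
    show ?thesis
    proof (cases "\<exists>k\<in>A. load p S k \<le> 5/4 * LB t")
      case True
      then obtain k where k: "k \<in> A" "load p S k \<le> 5/4 * LB t" by blast
      have "least_loaded p S A j" using True False choice by auto
      then have "j \<in> A" "load p S j \<le> load p S k" using k by (auto simp: least)
      then show ?thesis using False k large_A by auto
    next
      case none: False
      then have "\<And>a. a \<in> A \<Longrightarrow> 5/4 * LB t < load p S a" by force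
      then show ?thesis using False none choice large_B by (auto simp: least)
    qed
  qed
qed

text \<open>
  \<open>z\<close> is the load of a machine of \<open>B\<close> before its last job; \<open>y\<close> is the value of \<open>L\<close> when that job
  arrived, and the second alternative applies when the job was small.
\<close>
definition inv_B :: "real \<Rightarrow> schedule \<Rightarrow> real \<Rightarrow> bool" where
  "inv_B x S z \<longleftrightarrow> z \<le> 3/4 * x \<or> (\<exists>y\<le>x. z \<le> 5/4 * y \<and> (\<forall>a\<in>A. 3/4 * y < light y S a))"

lemma inv_B_mono:
  assumes "inv_B x S z" "x \<le> x'" "dom S' \<subseteq> {1..n}" "\<And>a. a \<in> A \<Longrightarrow> jobs_on S a \<subseteq> jobs_on S' a"
  shows "inv_B x' S' z"
proof -
  have "z \<le> 3/4 * x \<Longrightarrow> z \<le> 3/4 * x'" using assms(2) by linarith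
  moreover have "light y S a \<le> light y S' a" if "a \<in> A" for y a
    using assms that by (intro light_mono) auto
  ultimately show ?thesis using assms(1,2) unfolding inv_B_def by (meson less_le_trans order_trans)
qed

text \<open>On a machine of \<open>B\<close> the job \<open>i\<close> stands for the last arrival
  there. Any such witness serves, since the removal phase takes a job at least as large.\<close>

definition arrival_inv :: "nat \<Rightarrow> schedule \<Rightarrow> bool" where
  "arrival_inv t S \<longleftrightarrow> dom S = {1..t} \<and> ran S \<subseteq> {1..m} \<and>
     (\<forall>a\<in>A. inv_A p (LB t) (jobs_on S a)) \<and>
     (\<forall>b\<in>B. jobs_on S b \<noteq> {} \<longrightarrow> (\<exists>i\<in>jobs_on S b. inv_B (LB t) S (load p S b - p i)))"

lemma arrival_inv_step:
  assumes inv: "arrival_inv t S" and choice: "arrival_choice 1.75 m p (Suc t) S j"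
    and t: "Suc t \<le> n"
  shows "arrival_inv (Suc t) (S(Suc t \<mapsto> j))"
proof -
  define S' where "S' = S(Suc t \<mapsto> j)"
  define x where "x = LB (Suc t)"
  have dom: "dom S = {1..t}" and ran: "ran S \<subseteq> {1..m}" using inv by (auto simp: arrival_inv_def)
  have new: "Suc t \<notin> dom S" and domn: "dom S \<subseteq> {1..n}" using dom t by auto
  have domn': "dom S' \<subseteq> {1..n}" using dom t by (auto simp: S'_def)
  have x: "0 < x" "LB t \<le> x" using LB_pos[of "Suc t"] LB_mono[of t "Suc t"] t by (auto simp: x_def)
  have pt: "0 < p (Suc t)" using pos t by simp
  have fin: "finite (jobs_on S k)" for k using finite_jobs_on[OF domn] .
  have jpos: "\<forall>i\<in>jobs_on S k. 0 < p i" for k using pos_jobs_on[OF domn] by blast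
  have newj: "Suc t \<notin> jobs_on S k" for k using new jobs_on_subset_dom by blast
  have jobs': "jobs_on S' k = (if k = j then insert (Suc t) (jobs_on S k) else jobs_on S k)" for k
    unfolding S'_def by (rule jobs_on_upd[OF new])
  have load': "load p S' k = (if k = j then p (Suc t) + load p S k else load p S k)" for k
    unfolding S'_def by (rule load_upd[OF domn new])
  have invA: "inv_A p x (jobs_on S a)" if "a \<in> A" for a
    using inv that inv_A_mono fin x unfolding arrival_inv_def by blast
  have inv_other_B: "\<exists>i\<in>jobs_on S' b. inv_B x S' (load p S' b - p i)"
    if b: "b \<in> B" "b \<noteq> j" "jobs_on S' b \<noteq> {}" for b
  proof -
    have "jobs_on S b \<noteq> {}" using b by (simp add: jobs')
    then obtain i where i: "i \<in> jobs_on S b" "inv_B (LB t) S (load p S b - p i)"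
      using inv b unfolding arrival_inv_def by blast
    have "inv_B x S' (load p S b - p i)"
      by (rule inv_B_mono[OF i(2) x(2) domn']) (auto simp: jobs')
    then show ?thesis using i b by (auto simp: jobs' load')
  qed
  have vol: "p (Suc t) + sum p {1..t} \<le> real m * x"
    using sum_le_LB[of "Suc t"] by (simp add: x_def)
  obtain k e where ke: "real (card A) = k" "real (card B) = k + e" "real m = 2 * k + e" "1 \<le> k"
      "e = 0 \<or> e = 1" by (rule machine_counts)
  have k0: "0 \<le> k" using ke by simp
  \<comment> \<open>The volume bound at time \<open>Suc t\<close>, with the chosen machine supplying
    the lower bound for all of \<open>B\<close>.\<close>
  have cap: "k * \<alpha> + (k + e) * load p S j + p (Suc t) \<le> (2 * k + e) * x"
    if "\<And>a. a \<in> A \<Longrightarrow> \<alpha> \<le> load p S a" "\<And>b. b \<in> B \<Longrightarrow> load p S j \<le> load p S b" for \<alpha>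
    using volume_le[OF ran _ that] vol dom ke by simp
  have "j \<in> {1..m} \<and> (j \<in> A \<longrightarrow> inv_A p x (jobs_on S' j)) \<and> (j \<in> B \<longrightarrow> inv_B x S' (load p S j))"
    using choice
  proof (cases rule: arrival_choice_cases)
    case small_A
    have "p i \<le> x" if "i \<in> jobs_on S j" for i
      using job_le_L[of i "Suc t" p m] that dom jobs_on_subset_dom[of S j] by (force simp: x_def)
    then have "inv_A p x (insert (Suc t) (jobs_on S j))"
      using inv_A_insert_small[OF invA[OF small_A(2)] fin newj pt _ jpos] small_A
      by (simp add: x_def light_def)
    then have "inv_A p x (jobs_on S' j)" by (simp add: jobs')
    then show ?thesis using A_D[OF small_A(2)] by blast
  next
    case small_B
    \<comment> \<open>Otherwise a pair of machines carries more than
      \<open>3/4 * x + 5/4 * x\<close> and the odd machine more than \<open>x\<close>, so no volume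
      is left for the new job.\<close>
    have "load p S j \<le> 5/4 * x"
    proof (rule ccontr)
      assume "\<not> ?thesis"
      then have less: "5/4 * x < load p S j" by simp
      have "3/4 * x \<le> load p S a" if "a \<in> A" for a
        using small_B(4)[OF that] light_le_load[OF domn, of x a] by (simp add: x_def)
      from cap[OF this small_B(3)]
      have "k * (3/4 * x) + (k + e) * load p S j + p (Suc t) \<le> (2 * k + e) * x" by blast
      moreover have "k * (5/4 * x) \<le> k * load p S j" using k0 less by (intro mult_left_mono) auto
      ultimately show False using ke(5) less x pt by (auto simp: algebra_simps)
    qed
    moreover have "3/4 * x < light x S' a" if "a \<in> A" for a
      using small_B that light_mono[OF domn', of S a x x] by (force simp: jobs' x_def)
    ultimately have "inv_B x S' (load p S j)" unfolding inv_B_def by blast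
    then show ?thesis using B_D[OF small_B(2)] by blast
  next
    case large_A
    have "inv_A p x (insert (Suc t) (jobs_on S j))"
      using inv_A_insert_large[OF invA[OF large_A(2)] fin newj _ jpos x(1)] large_A
      by (simp add: x_def load_def)
    then have "inv_A p x (jobs_on S' j)" by (simp add: jobs')
    then show ?thesis using A_D[OF large_A(2)] by blast
  next
    case large_B
    \<comment> \<open>Otherwise each pair carries more than \<open>2 * x\<close>; an odd machine is
      less than \<open>x / 4\<close> short of \<open>x\<close>, but the new job adds more than
      \<open>x / 2\<close>.\<close>
    have "load p S j \<le> 3/4 * x"
    proof (rule ccontr)
      assume "\<not> ?thesis"
      then have less: "3/4 * x < load p S j" by simp
      have "5/4 * x \<le> load p S a" if "a \<in> A" for a
        using large_B(4)[OF that] by (simp add: x_def)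
      from cap[OF this large_B(3)]
      have "k * (5/4 * x) + (k + e) * load p S j + p (Suc t) \<le> (2 * k + e) * x" by blast
      moreover have "k * (3/4 * x) \<le> k * load p S j" using k0 less by (intro mult_left_mono) auto
      moreover have "x / 2 < p (Suc t)" using large_B by (simp add: x_def)
      ultimately show False using ke(5) less x by (auto simp: algebra_simps)
    qed
    then have "inv_B x S' (load p S j)" unfolding inv_B_def by blast
    then show ?thesis using B_D[OF large_B(2)] by blast
  qed
  moreover have "load p S' j - p (Suc t) = load p S j" by (simp add: load')
  moreover have "dom S' = {1..Suc t}" using dom by (auto simp: S'_def)
  moreover have "ran S' \<subseteq> insert j (ran S)" unfolding S'_def by (auto simp: ran_def)
  ultimately show ?thesis
    using ran invA inv_other_B unfolding arrival_inv_def S'_def[symmetric] x_def[symmetric]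
    by (auto simp: jobs')
qed

lemma arrival_inv:
  assumes "arrival 1.75 m p t S" "t \<le> n"
  shows "arrival_inv t S"
  using assms
proof (induction rule: arrival.induct)
  case arrival_0
  have "0 \<le> LB 0" using L_ge(1)[of p 0 m] by simp
  then show ?case by (simp add: arrival_inv_def jobs_on_def inv_A_empty)
next
  case (arrival_Suc t S j)
  then show ?case by (intro arrival_inv_step) simp_all
qed


section \<open>The migration phase\<close>

text \<open>Removing a largest job lowers the load at least as much as removing the witness of
  \<open>arrival_inv\<close>, so \<open>inv_B\<close> holds for the remaining load. The claims on
  \<open>B\<close> are read off from it.\<close>

lemma removal_B_result:
  assumes inv: "arrival_inv n S0" and rem: "removal_B m p S0 (S1, R1)"
  shows "R1 \<union> dom S1 = {1..n}" "R1 \<inter> dom S1 = {}" "ran S1 \<subseteq> {1..m}" "card R1 \<le> card B"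
    and "\<And>a. a \<in> A \<Longrightarrow> jobs_on S1 a = jobs_on S0 a"
    and "\<And>b. b \<in> B \<Longrightarrow> load p S1 b \<le> 5/4 * LB n"
    and "\<And>a b. a \<in> A \<Longrightarrow> b \<in> B \<Longrightarrow> 3/4 * LB n < load p S1 b \<Longrightarrow> LB n / 4 < light (LB n) S1 a"
proof -
  define B' where "B' = {j \<in> B. jobs_on S0 j \<noteq> {}}"
  obtain r where r: "\<And>j. j \<in> B' \<Longrightarrow> largest_job_on p S0 j (r j)"
    and R1: "R1 = r ` B'" and S1: "S1 = S0 |` (- R1)"
    using rem unfolding removal_B_def B'_def by (auto simp: Let_def)
  have dom: "dom S0 = {1..n}" and ran: "ran S0 \<subseteq> {1..m}" using inv by (auto simp: arrival_inv_def)
  have r_on: "r j \<in> jobs_on S0 j" and r_max: "\<And>i. i \<in> jobs_on S0 j \<Longrightarrow> p i \<le> p (r j)"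
    if "j \<in> B'" for j
    using r[OF that] by (force simp: largest_job_on_def is_arg_max_linorder)+
  have "R1 \<subseteq> dom S0" unfolding R1 using r_on jobs_on_subset_dom by blast
  then show "R1 \<union> dom S1 = {1..n}" "R1 \<inter> dom S1 = {}" by (auto simp: S1 dom)
  then have dom1: "dom S1 \<subseteq> {1..n}" by blast
  show "ran S1 \<subseteq> {1..m}" using ran by (auto simp: S1 ran_def restrict_map_def split: if_splits)
  have "card R1 \<le> card B'" unfolding R1 by (intro card_image_le) (auto simp: B'_def machines)
  also have "\<dots> \<le> card B" by (intro card_mono) (auto simp: B'_def machines)
  finally show "card R1 \<le> card B" .
  have jobs1: "jobs_on S1 j = jobs_on S0 j - R1" for j
    by (auto simp: S1 jobs_on_def restrict_map_def split: if_splits)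
  have R1_on: "jobs_on S0 j \<inter> R1 = (if j \<in> B' then {r j} else {})" for j
  proof -
    have "k = j" if "r k \<in> jobs_on S0 j" "k \<in> B'" for k
      using that r_on[OF that(2)] by (auto simp: jobs_on_def)
    then show ?thesis using r_on by (auto simp: R1)
  qed
  show same: "jobs_on S1 a = jobs_on S0 a" if "a \<in> A" for a
    using R1_on[of a] A_D[OF that] by (auto simp: jobs1 B'_def)
  have "inv_B (LB n) S1 (load p S1 b)" if b: "b \<in> B" for b
  proof (cases "b \<in> B'")
    case True
    then obtain i where i: "i \<in> jobs_on S0 b" "inv_B (LB n) S0 (load p S0 b - p i)"
      using inv b unfolding arrival_inv_def B'_def by blast
    have "jobs_on S1 b = jobs_on S0 b - {r b}" using R1_on[of b] True jobs1 by auto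
    then have "load p S1 b = load p S0 b - p (r b)"
      using r_on[OF True] finite_jobs_on[of S0 b] dom by (simp add: load_def sum_diff1)
    then have "load p S1 b \<le> load p S0 b - p i" using r_max[OF True i(1)] by simp
    then have "inv_B (LB n) S0 (load p S1 b)" using i(2) unfolding inv_B_def by (meson order_trans)
    then show ?thesis by (rule inv_B_mono) (use dom1 same in auto)
  next
    case False
    then have "jobs_on S1 b = {}" using b jobs1 by (auto simp: B'_def)
    then show ?thesis using LB_nonneg by (simp add: inv_B_def load_def)
  qed
  note invB = this
  show "load p S1 b \<le> 5/4 * LB n" if "b \<in> B" for b
    using invB[OF that] LB_nonneg unfolding inv_B_def by force
  show "LB n / 4 < light (LB n) S1 a" if ab: "a \<in> A" "b \<in> B" "3/4 * LB n < load p S1 b" for a b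
  proof -
    \<comment> \<open>A load above \<open>3/4 * LB n\<close> rules out the first alternative of
      \<open>inv_B\<close>. The second gives \<open>y\<close> above \<open>3/5 * LB n\<close>, so
      \<open>3/4 * y\<close> exceeds \<open>9/20 * LB n\<close>, more than enough for a
      quarter.\<close>
    obtain y where y: "y \<le> LB n" "load p S1 b \<le> 5/4 * y" "3/4 * y < light y S1 a"
      using invB[OF ab(2)] ab unfolding inv_B_def by force
    have "light y S1 a \<le> light (LB n) S1 a" using light_mono[OF dom1 _ y(1)] by blast
    then show ?thesis using y ab(3) LB_nonneg by linarith
  qed
qed

text \<open>
  If the largest job on an overloaded machine is at most \<open>LB n / 2\<close>, then so are all jobs there, and more than \<open>3/4 LB n - LB n / 2\<close> remains.
\<close>
lemma removal_A_step_light: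
  assumes dom: "dom S \<subseteq> {1..n}" and i: "largest_job_on p S j i" and heavy: "3/4 * LB n < load p S j"
    and light: "LB n / 4 < light (LB n) S a"
  shows "LB n / 4 < light (LB n) (S(i := None)) a"
proof -
  have i_on: "i \<in> jobs_on S j" and i_max: "\<And>k. k \<in> jobs_on S j \<Longrightarrow> p k \<le> p i"
    using i by (auto simp: largest_job_on_def is_arg_max_linorder)
  have jobs: "jobs_on (S(i := None)) k = jobs_on S k - {i}" for k
    by (auto simp: jobs_on_def)
  show ?thesis
  proof (cases "i \<in> jobs_on S a \<and> p i \<le> LB n / 2")
    case True
    then have "a = j" using i_on by (auto simp: jobs_on_def)
    have "{k \<in> jobs_on (S(i := None)) a. p k \<le> LB n / 2} = jobs_on S j - {i}"
      using True i_max unfolding jobs \<open>a = j\<close> by fastforce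
    then have "light (LB n) (S(i := None)) a = load p S j - p i"
      using i_on finite_jobs_on[OF dom] by (simp add: light_def load_def sum_diff1)
    then show ?thesis using heavy True by linarith
  next
    case False
    then have "{k \<in> jobs_on (S(i := None)) a. p k \<le> LB n / 2} = {k \<in> jobs_on S a. p k \<le> LB n / 2}"
      unfolding jobs by auto
    then show ?thesis using light by (simp add: light_def)
  qed
qed

text \<open>\<open>k a\<close> is a budget of removals for machine \<open>a\<close>. By
  \<open>trimmable_remove_largest\<close> each greedy removal lowers one budget by 1, so the sum of
  the budgets bounds the number of removals.\<close>

lemma removal_A_result:
  assumes "removal_A 1.75 m p n (S, R) (S', R')"
    and "R \<union> dom S = {1..n}" "R \<inter> dom S = {}" "ran S \<subseteq> {1..m}"
    and "\<And>a. a \<in> A \<Longrightarrow> trimmable p (jobs_on S a) (k a) (3/4 * LB n)"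
  shows "R' \<union> dom S' = {1..n} \<and> R' \<inter> dom S' = {} \<and> ran S' \<subseteq> {1..m} \<and>
    card R' \<le> card R + sum k A \<and>
    (\<forall>a\<in>A. load p S' a \<le> 3/4 * LB n) \<and> (\<forall>b\<in>B. load p S' b = load p S b) \<and>
    ((\<forall>a\<in>A. LB n / 4 < light (LB n) S a) \<longrightarrow> (\<forall>a\<in>A. LB n / 4 < light (LB n) S' a))"
  using assms
proof (induction "(S, R)" "(S', R')" arbitrary: S R k rule: removal_A.induct)
  case removal_A_done
  then show ?case by simp
next
  case (removal_A_step j S i R)
  have heavy: "3/4 * LB n < load p S j" using removal_A_step by simp
  have dom: "dom S \<subseteq> {1..n}" using removal_A_step by blast
  have i_on: "i \<in> jobs_on S j" and i_max: "\<forall>k\<in>jobs_on S j. p k \<le> p i"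
    using removal_A_step by (auto simp: largest_job_on_def is_arg_max_linorder)
  have Si: "S i = Some j" using i_on by (simp add: jobs_on_def)
  have jobs: "jobs_on (S(i := None)) a = (if a = j then jobs_on S a - {i} else jobs_on S a)" for a
    using Si by (auto simp: jobs_on_def)
  obtain k' where k': "k j = Suc k'" "trimmable p (jobs_on S j - {i}) k' (3/4 * LB n)"
    using trimmable_remove_largest[OF removal_A_step.prems(4)[OF removal_A_step.hyps(1)]
        finite_jobs_on[OF dom] heavy[unfolded load_def] i_on i_max] by blast
  define k2 where "k2 = k(j := k')"
  have trim: "trimmable p (jobs_on (S(i := None)) a) (k2 a) (3/4 * LB n)" if "a \<in> A" for a
    using removal_A_step.prems(4)[OF that] k' by (simp add: jobs k2_def)
  have "insert i R \<union> dom (S(i := None)) = {1..n}" "insert i R \<inter> dom (S(i := None)) = {}"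
    using removal_A_step.prems(1,2) Si by auto
  moreover have "ran (S(i := None)) \<subseteq> {1..m}"
    using removal_A_step.prems(3) by (auto simp: ran_def split: if_splits)
  ultimately have IH: "R' \<union> dom S' = {1..n} \<and> R' \<inter> dom S' = {} \<and> ran S' \<subseteq> {1..m} \<and>
    card R' \<le> card (insert i R) + sum k2 A \<and>
    (\<forall>a\<in>A. load p S' a \<le> 3/4 * LB n) \<and> (\<forall>b\<in>B. load p S' b = load p (S(i := None)) b) \<and>
    ((\<forall>a\<in>A. LB n / 4 < light (LB n) (S(i := None)) a) \<longrightarrow> (\<forall>a\<in>A. LB n / 4 < light (LB n) S' a))"
    by (rule removal_A_step.hyps(5)[OF _ _ _ trim])
  have "sum k A = Suc (sum k2 A)"
    using sum.remove[OF machines(3) removal_A_step.hyps(1), of k]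
      sum.remove[OF machines(3) removal_A_step.hyps(1), of k2] k'
    by (simp add: k2_def)
  moreover have "card (insert i R) \<le> Suc (card R)" by (rule card_insert_le_m1) simp_all
  moreover have "load p (S(i := None)) b = load p S b" if "b \<in> B" for b
    using A_D[OF removal_A_step.hyps(1)] that by (auto simp: load_def jobs)
  moreover have "LB n / 4 < light (LB n) (S(i := None)) a" if "LB n / 4 < light (LB n) S a" for a
    using removal_A_step_light[OF dom removal_A_step.hyps(3) heavy that] .
  ultimately show ?case using IH by auto
qed

section \<open>Reassignment of the removed jobs\<close>

lemma reassign_choice_cases:
  assumes "reassign_choice 1.75 m p n S i j"
  obtains "j \<in> B" "load p S j + p i \<le> 7/4 * LB n"
  | "j \<in> A" "\<And>a. a \<in> A \<Longrightarrow> load p S j \<le> load p S a"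
    "\<And>b. b \<in> B \<Longrightarrow> 7/4 * LB n < load p S b + p i"
proof (cases "\<exists>k\<in>B. load p S k + p i \<le> 7/4 * LB n")
  case True
  then show ?thesis using assms that(1) by (simp add: reassign_choice_def)
next
  case False
  then have "least_loaded p S A j" using assms by (simp add: reassign_choice_def)
  then show ?thesis using False that(2)
    by (force simp: least_loaded_def is_arg_min_linorder)
qed

context
  fixes S2 :: schedule
  assumes load2_A: "\<And>a. a \<in> A \<Longrightarrow> load p S2 a \<le> 3/4 * LB n"
    and light2: "\<And>a b. a \<in> A \<Longrightarrow> b \<in> B \<Longrightarrow> 3/4 * LB n < load p S2 b \<Longrightarrow> LB n / 4 < light (LB n) S2 a"
begin

text \<open>
  If the job does not fit on \<open>B\<close> and would overload \<open>A\<close>, then it exceeds \<open>3/4 LB n\<close> by volume.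
  Every machine of \<open>A\<close> then has received a job that is at least as large. As at most \<open>m\<close> jobs
  exceed \<open>LB n / 2\<close>, some machine of \<open>B\<close> carries no such job, hence no reassigned job. It was
  therefore heavy already in \<open>S2\<close>, which forces light jobs of total size more than \<open>LB n / 4\<close> onto
  each machine of \<open>A\<close> besides the reassigned one; again this exceeds the volume bound.
\<close>
lemma reassign_fits:
  assumes sub: "S2 \<subseteq>\<^sub>m S" and dom: "dom S \<subseteq> {1..n}" and ran: "ran S \<subseteq> {1..m}"
    and i: "i \<in> {1..n}" "i \<notin> dom S"
    and large: "\<And>k. k \<in> dom S - dom S2 \<Longrightarrow> p i \<le> p k"
    and B: "\<And>b. b \<in> B \<Longrightarrow> 7/4 * LB n < load p S b + p i"
  shows "\<exists>a\<in>A. load p S a + p i \<le> 7/4 * LB n"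
proof (rule ccontr)
  assume "\<not> ?thesis"
  then have A: "7/4 * LB n < load p S a + p i" if "a \<in> A" for a using that by force
  define x where "x = LB n"
  \<comment> \<open>If job \<open>i\<close> fits nowhere, every load exceeds
    \<open>\<beta>\<close>.\<close>
  define \<beta> where "\<beta> = 7/4 * x - p i"
  have pi: "0 < p i" "p i \<le> x" using pos job_le_L i(1) by (auto simp: x_def)
  have fin: "finite (dom S)" using dom finite_subset by blast
  have "p i + sum p (dom S) = sum p (insert i (dom S))" using i(2) fin by simp
  also have "\<dots> \<le> sum p {1..n}"
    using dom i(1) pos by (intro sum_mono2) (auto intro: less_imp_le)
  also have "\<dots> \<le> real m * x" unfolding x_def by (rule sum_le_LB)
  finally have vol: "p i + sum p (dom S) \<le> real m * x" .
  obtain k e where ke: "real (card A) = k" "real (card B) = k + e" "real m = 2 * k + e" "1 \<le> k"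
      "e = 0 \<or> e = 1" by (rule machine_counts)
  have \<beta>_A: "\<beta> \<le> load p S a" if "a \<in> A" for a using A[OF that] by (simp add: \<beta>_def x_def)
  have \<beta>_B: "\<beta> \<le> load p S b" if "b \<in> B" for b using B[OF that] by (simp add: \<beta>_def x_def)
  have cap: "k * \<alpha> + (k + e) * \<beta> + p i \<le> (2 * k + e) * x" if "\<And>a. a \<in> A \<Longrightarrow> \<alpha> \<le> load p S a" for \<alpha>
    using volume_le[OF ran fin that \<beta>_B] vol ke by simp
  have big: "3/4 * x < p i"
  proof (rule ccontr)
    assume "\<not> ?thesis"
    then have "k * x \<le> k * \<beta>" "x \<le> \<beta>" using ke(4) by (auto simp: \<beta>_def intro!: mult_left_mono)
    moreover have "k * \<beta> + (k + e) * \<beta> + p i \<le> (2 * k + e) * x"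
      using cap[OF \<beta>_A] by blast
    ultimately show False using ke(5) pi by (auto simp: algebra_simps)
  qed
  have jobs2: "jobs_on S2 j \<subseteq> jobs_on S j" for j
    using sub by (auto simp: jobs_on_def map_le_def dom_def)
  have old: "k \<in> jobs_on S2 j" if "k \<in> jobs_on S j" "k \<in> dom S2" for k j
    using sub that unfolding jobs_on_def map_le_def by simp
  \<comment> \<open>Without a reassigned job the load of \<open>a\<close> is still at most
    \<open>3/4 * x\<close>, and job \<open>i\<close>, at most \<open>x\<close>, would fit.\<close>
  have new: "\<exists>k\<in>jobs_on S a. k \<notin> dom S2" if "a \<in> A" for a
  proof (rule ccontr)
    assume "\<not> ?thesis"
    then have "jobs_on S a \<subseteq> jobs_on S2 a" using old by blast
    then have "load p S a = load p S2 a" using jobs2[of a] by (simp add: load_def)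
    then show False using A[OF that] load2_A[OF that] pi by (simp add: x_def)
  qed
  have large_new: "x / 2 < p k" if "k \<in> jobs_on S j" "k \<notin> dom S2" for k j
  proof -
    have "p i \<le> p k" using large that jobs_on_subset_dom by blast
    then show ?thesis using big pi by linarith
  qed
  have "\<exists>b\<in>B. \<forall>k\<in>jobs_on S b. p k \<le> x / 2"
  proof (rule ccontr)
    assume no_b: "\<not> ?thesis"
    have "\<exists>k\<in>jobs_on S j. x / 2 < p k" if "j \<in> {1..m}" for j
    proof (cases "j \<in> A")
      case True
      then show ?thesis using new large_new by blast
    next
      case False
      then have "j \<in> B" using that machines(1) by blast
      then show ?thesis using no_b not_le by metis
    qed
    then obtain f where f: "\<And>j. j \<in> {1..m} \<Longrightarrow> f j \<in> jobs_on S j \<and> x / 2 < p (f j)" by metis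
    have inj: "inj_on f {1..m}"
    proof (rule inj_onI)
      fix j k assume "j \<in> {1..m}" "k \<in> {1..m}" "f j = f k"
      then show "j = k" using f[of j] f[of k] by (simp add: jobs_on_def)
    qed
    have f_dom: "f ` {1..m} \<subseteq> dom S" using f jobs_on_subset_dom by blast
    then have "i \<notin> f ` {1..m}" using i(2) by blast
    then have "card (insert i (f ` {1..m})) = Suc m" using inj by (simp add: card_image)
    moreover have "insert i (f ` {1..m}) \<subseteq> {k \<in> {1..n}. x / 2 < p k}"
    proof -
      have "f ` {1..m} \<subseteq> {1..n}" using f_dom dom by blast
      then show ?thesis using f i big pi by auto
    qed
    from card_mono[OF _ this] have "card (insert i (f ` {1..m})) \<le> m"
      using card_large_le[of n m p] by (simp add: x_def)
    ultimately show False by simp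
  qed
  then obtain b where b: "b \<in> B" "\<And>k. k \<in> jobs_on S b \<Longrightarrow> p k \<le> x / 2" by blast
  have "jobs_on S b \<subseteq> jobs_on S2 b"
    using b(2) large_new[of _ b] old not_le by blast
  then have "load p S b = load p S2 b" using jobs2[of b] by (simp add: load_def)
  then have heavy: "3/4 * LB n < load p S2 b" using B[OF b(1)] pi by (simp add: x_def)
  have "x / 4 + p i \<le> load p S a" if "a \<in> A" for a
  proof -
    obtain k where k: "k \<in> jobs_on S a" "k \<notin> dom S2" using new \<open>a \<in> A\<close> by blast
    define K where "K = {i \<in> jobs_on S2 a. p i \<le> x / 2}"
    have K2: "K \<subseteq> jobs_on S2 a" by (auto simp: K_def)
    have K: "k \<notin> K" using k(2) K2 jobs_on_subset_dom[of S2 a] by (meson subsetD)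
    have kK: "insert k K \<subseteq> jobs_on S a" using k(1) K2 jobs2[of a] by simp
    have "sum p (insert k K) \<le> load p S a"
      unfolding load_def using finite_jobs_on[OF dom] kK pos_jobs_on[OF dom]
      by (intro sum_mono2) (auto intro: less_imp_le)
    moreover have "finite K"
      by (rule finite_subset[OF _ finite_jobs_on[OF dom, of a]]) (use kK in simp)
    moreover have "x / 4 < sum p K"
      using light2[OF that b(1) heavy] by (simp add: light_def K_def x_def)
    moreover have "p i \<le> p k" using large k jobs_on_subset_dom by blast
    ultimately show ?thesis using K by simp
  qed
  from cap[OF this] have "k * (x / 4 + p i) + (k + e) * \<beta> + p i \<le> (2 * k + e) * x" by blast
  \<comment> \<open>In \<open>x / 4 + p i + \<beta>\<close> the term \<open>p i\<close> cancels and
    \<open>2 * x\<close> remains, so the pairs alone use up their share of the volume; an odd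
    machine with load at least \<open>\<beta>\<close>, together with job \<open>i\<close>, exceeds
    \<open>x\<close>.\<close>
  moreover have "k * (x / 4 + p i) + (k + e) * \<beta> = 2 * (k * x) + e * \<beta>"
    by (simp add: \<beta>_def field_simps)
  ultimately have "e * \<beta> + p i \<le> e * x" by (simp add: distrib_right)
  then show False using ke(5) pi by (auto simp: \<beta>_def)
qed

text \<open>The sorting enters as an invariant: jobs already reassigned are at least as large as
  those pending, which is what \<open>reassign_fits\<close> requires of the next job.\<close>

lemma reassign_result:
  assumes "reassign 1.75 m p n S is S'"
    and "S2 \<subseteq>\<^sub>m S" "dom S \<union> set is = {1..n}" "dom S \<inter> set is = {}" "distinct is" "ran S \<subseteq> {1..m}"
    and "sorted_wrt (\<lambda>i k. p i \<ge> p k) is"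
    and "\<And>i k. i \<in> dom S - dom S2 \<Longrightarrow> k \<in> set is \<Longrightarrow> p k \<le> p i"
    and "\<And>j. j \<in> {1..m} \<Longrightarrow> load p S j \<le> 7/4 * LB n"
  shows "dom S' = {1..n} \<and> ran S' \<subseteq> {1..m} \<and> (\<forall>j\<in>{1..m}. load p S' j \<le> 7/4 * LB n)"
  using assms
proof (induction rule: reassign.induct)
  case (reassign_Nil S)
  then show ?case by simp
next
  case (reassign_Cons S i j "is" S')
  have i: "i \<in> {1..n}" "i \<notin> dom S" and dom: "dom S \<subseteq> {1..n}" using reassign_Cons.prems by auto
  have "j \<in> {1..m} \<and> load p S j + p i \<le> 7/4 * LB n"
    using reassign_Cons.hyps(1)
  proof (cases rule: reassign_choice_cases)
    case 1
    then show ?thesis using B_D by blast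
  next
    case 2
    obtain a where "a \<in> A" "load p S a + p i \<le> 7/4 * LB n"
      using reassign_fits[OF reassign_Cons.prems(1) dom reassign_Cons.prems(5) i _ 2(3)]
        reassign_Cons.prems(7) by auto
    then show ?thesis using 2(2)[of a] A_D[OF 2(1)] by simp
  qed
  note j = this
  show ?case
  proof (rule reassign_Cons.IH)
    show "S2 \<subseteq>\<^sub>m S(i \<mapsto> j)"
      using reassign_Cons.prems(1) i(2) unfolding map_le_def by (metis domIff fun_upd_other)
    show "dom (S(i \<mapsto> j)) \<union> set is = {1..n}" "dom (S(i \<mapsto> j)) \<inter> set is = {}" "distinct is"
      using reassign_Cons.prems(2-4) by auto
    show "ran (S(i \<mapsto> j)) \<subseteq> {1..m}" using reassign_Cons.prems(5) j by (auto simp: ran_def)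
    show "sorted_wrt (\<lambda>i k. p i \<ge> p k) is" using reassign_Cons.prems(6) by simp
    show "p k \<le> p l" if "l \<in> dom (S(i \<mapsto> j)) - dom S2" "k \<in> set is" for l k
      using reassign_Cons.prems(6,7) that by (cases "l = i") auto
    show "load p (S(i \<mapsto> j)) l \<le> 7/4 * LB n" if "l \<in> {1..m}" for l
      using reassign_Cons.prems(8)[OF that] j by (simp add: load_upd[OF dom i(2)] add.commute)
  qed
qed

end

section \<open>Final loads and the number of migrations\<close>

lemma ALG_result:
  assumes "(S, R) \<in> ALG 1.75 m n p"
  shows "S \<in> schedules m n" "makespan m p S \<le> 7/4 * LB n" "finite R" "real (card R) \<le> 5/2 * real m"
proof -
  obtain S0 S1 R1 S2 "is" where arr: "arrival 1.75 m p n S0" and rB: "removal_B m p S0 (S1, R1)"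
    and rA: "removal_A 1.75 m p n (S1, R1) (S2, R)"
    and "is": "distinct is" "set is = R" "sorted_wrt (\<lambda>i k. p i \<ge> p k) is"
    and re: "reassign 1.75 m p n S2 is S"
    using assms unfolding ALG_def by auto
  have inv: "arrival_inv n S0" using arrival_inv[OF arr] by simp
  note B_res = removal_B_result[OF inv rB]
  have trim: "trimmable p (jobs_on S1 a) 4 (3/4 * LB n)" if "a \<in> A" for a
    using inv that B_res(5)[OF that] by (simp add: arrival_inv_def inv_A_def)
  note A_res = removal_A_result[OF rA B_res(1,2,3) trim]
  have R: "R \<subseteq> {1..n}" using A_res by blast
  then show "finite R" using finite_subset by blast
  obtain k e where ke: "real (card A) = k" "real (card B) = k + e" "real m = 2 * k + e" "1 \<le> k"
      "e = 0 \<or> e = 1" by (rule machine_counts)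
  \<comment> \<open>One removal per machine of \<open>B\<close> and four per machine of
    \<open>A\<close> give \<open>5 * k + e\<close>, at most 5/2 of \<open>2 * k + e\<close>.\<close>
  have "card R \<le> card B + 4 * card A" using A_res B_res(4) by simp
  then have "real (card R) \<le> real (card B + 4 * card A)" by (rule of_nat_mono)
  then show "real (card R) \<le> 5/2 * real m" using ke by auto
  have loads: "load p S2 j \<le> 7/4 * LB n" if "j \<in> {1..m}" for j
  proof (cases "j \<in> A")
    case True
    then show ?thesis using A_res LB_nonneg by force
  next
    case False
    then have "j \<in> B" using that machines(1) by blast
    then show ?thesis using A_res B_res(6)[of j] LB_nonneg by force
  qed
  have S: "dom S = {1..n} \<and> ran S \<subseteq> {1..m} \<and> (\<forall>j\<in>{1..m}. load p S j \<le> 7/4 * LB n)"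
  proof (rule reassign_result[OF _ _ re])
    show "LB n / 4 < light (LB n) S2 a" if "a \<in> A" "b \<in> B" "3/4 * LB n < load p S2 b" for a b
      using A_res B_res(7)[of _ b] that by auto
  qed (use A_res "is" loads in auto)
  then show "S \<in> schedules m n" by (simp add: schedules_def)
  show "makespan m p S \<le> 7/4 * LB n"
    using S two_machines unfolding makespan_def by (subst Max_le_iff) auto
qed

section \<open>Existence of an outcome\<close>

lemma ex_least_loaded: "finite X \<Longrightarrow> X \<noteq> {} \<Longrightarrow> \<exists>j. least_loaded p S X j"
  unfolding least_loaded_def by (rule ex_is_arg_min_if_finite)

lemma ex_largest_job_on: "finite (jobs_on S j) \<Longrightarrow> jobs_on S j \<noteq> {} \<Longrightarrow> \<exists>i. largest_job_on p S j i"
  using ex_is_arg_min_if_finite[of "jobs_on S j" "\<lambda>i. - p i"]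
  by (simp add: largest_job_on_def is_arg_min_def is_arg_max_def)

lemma ex_arrival_choice: "\<exists>j. arrival_choice c m p t S j"
proof -
  define A' where "A' = {k \<in> A. small_load c m p t S k \<le> (c - 1) * LB t}"
  have "\<exists>j. is_arg_min (small_load c m p t S) (\<lambda>k. k \<in> A') j" if "A' \<noteq> {}"
    using that machines(3) by (intro ex_is_arg_min_if_finite) (simp_all add: A'_def)
  then show ?thesis
    using ex_least_loaded[OF machines(3,5), of S] ex_least_loaded[OF machines(4,6), of S]
    unfolding arrival_choice_def Let_def A'_def[symmetric]
    by (cases "small_at c m p t t"; cases "A' = {}"; cases "\<exists>k\<in>A. load p S k \<le> (3 - c) * LB t")
      (simp_all only: if_True if_False simp_thms)
qed

lemma ex_arrival: "\<exists>S. arrival c m p t S"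
proof (induction t)
  case (Suc t)
  then show ?case using ex_arrival_choice arrival_Suc by meson
qed (auto intro: arrival_0)

lemma ex_removal_B:
  assumes "dom S \<subseteq> {1..n}"
  shows "\<exists>SR. removal_B m p S SR"
proof -
  have "\<forall>j\<in>B. jobs_on S j \<noteq> {} \<longrightarrow> (\<exists>i. largest_job_on p S j i)"
    using ex_largest_job_on finite_jobs_on[OF assms] by blast
  then obtain r where "\<forall>j\<in>B. jobs_on S j \<noteq> {} \<longrightarrow> largest_job_on p S j (r j)" by metis
  then show ?thesis unfolding removal_B_def Let_def by blast
qed

text \<open>Every removal unassigns a job, so the loop ends. With \<open>1 \<le> c\<close> the
  threshold is nonnegative, so an overloaded machine does have a job to remove.\<close>

lemma ex_removal_A:
  assumes "dom S \<subseteq> {1..n}" "1 \<le> c"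
  shows "\<exists>SR. removal_A c m p n (S, R) SR"
  using assms
proof (induction "card (dom S)" arbitrary: S R rule: less_induct)
  case less
  show ?case
  proof (cases "\<forall>j\<in>A. load p S j \<le> (c - 1) * LB n")
    case True
    then show ?thesis by (blast intro: removal_A_done)
  next
    case False
    then obtain j where j: "j \<in> A" "(c - 1) * LB n < load p S j" by force
    have "0 \<le> (c - 1) * LB n" using less.prems(2) LB_nonneg by simp
    then have "jobs_on S j \<noteq> {}" using j by (auto simp: load_def)
    then obtain i where i: "largest_job_on p S j i"
      using ex_largest_job_on finite_jobs_on[OF less.prems(1)] by blast
    then have "i \<in> dom S"
      using jobs_on_subset_dom[of S j] by (auto simp: largest_job_on_def is_arg_max_def)
    moreover have "finite (dom S)" using less.prems(1) finite_subset by blast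
    ultimately have "card (dom (S(i := None))) < card (dom S)"
      by (simp add: card_Diff1_less del: card_Diff_insert)
    moreover have "dom (S(i := None)) \<subseteq> {1..n}" using less.prems(1) by auto
    ultimately obtain SR where "removal_A c m p n (S(i := None), insert i R) SR"
      using less.hyps less.prems(2) by blast
    then show ?thesis using removal_A_step[OF j i] by blast
  qed
qed

lemma ex_reassign_choice: "\<exists>j. reassign_choice c m p n S i j"
  using ex_least_loaded[OF machines(3,5), of S] unfolding reassign_choice_def by auto

lemma ex_reassign: "\<exists>S'. reassign c m p n S is S'"
proof (induction "is" arbitrary: S)
  case (Cons i "is")
  then show ?case using ex_reassign_choice reassign_Cons by meson
qed (auto intro: reassign_Nil)

lemma ALG_nonempty: "ALG 1.75 m n p \<noteq> {}"
proof -
  obtain S0 where arr: "arrival 1.75 m p n S0" using ex_arrival by blast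
  then have inv: "arrival_inv n S0" using arrival_inv by blast
  then have "dom S0 \<subseteq> {1..n}" by (simp add: arrival_inv_def)
  then obtain S1 R1 where rB: "removal_B m p S0 (S1, R1)" using ex_removal_B by (metis surj_pair)
  note B_res = removal_B_result[OF inv rB]
  have "dom S1 \<subseteq> {1..n}" using B_res(1) by blast
  then obtain S2 R where rA: "removal_A 1.75 m p n (S1, R1) (S2, R)"
  proof -
    have "1 \<le> (1.75 :: real)" by simp
    with \<open>dom S1 \<subseteq> {1..n}\<close> show thesis using ex_removal_A that by (metis surj_pair)
  qed
  have "trimmable p (jobs_on S1 a) 4 (3/4 * LB n)" if "a \<in> A" for a
    using inv that B_res(5)[OF that] by (simp add: arrival_inv_def inv_A_def)
  \<comment> \<open>Finiteness of \<open>R\<close> is what allows its jobs to be listed for the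
    reassignment.\<close>
  from removal_A_result[OF rA B_res(1,2,3) this] have "R \<subseteq> {1..n}" by blast
  then have "finite R" using finite_subset by blast
  define "is" where "is = rev (sort_key p (sorted_list_of_set R))"
  have "sorted_wrt (\<lambda>i k. p i \<ge> p k) is"
    unfolding is_def sorted_wrt_rev using sorted_sort_key[of p] by (simp add: sorted_map)
  moreover have "distinct is" "set is = R" using \<open>finite R\<close> by (simp_all add: is_def)
  moreover obtain S where "reassign 1.75 m p n S2 is S" using ex_reassign by blast
  ultimately have "(S, R) \<in> ALG 1.75 m n p"
    unfolding ALG_def using arr rB rA by blast
  then show ?thesis by blast
qed

end

theorem theorem5:
  fixes m :: nat
  assumes "m \<ge> 2"
  shows "competitive 1.75 m (ALG 1.75 m) \<and> migrations_at_most (2.5 * real m) (ALG 1.75 m)"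
proof -
  have "ALG 1.75 m n p \<noteq> {} \<and> (\<forall>(S, R)\<in>ALG 1.75 m n p.
      S \<in> schedules m n \<and> makespan m p S \<le> 1.75 * opt_makespan m n p \<and>
      finite R \<and> real (card R) \<le> 2.5 * real m)" if "job_sequence n p" for n p
  proof -
    interpret job_instance m n p
      using assms that by unfold_locales (auto simp: job_sequence_def)
    have "LB n \<le> opt_makespan m n p" using L_le_opt pos assms by simp
    then have le: "7/4 * LB n \<le> 1.75 * opt_makespan m n p" by simp
    have "S \<in> schedules m n \<and> makespan m p S \<le> 1.75 * opt_makespan m n p \<and>
        finite R \<and> real (card R) \<le> 2.5 * real m" if "(S, R) \<in> ALG 1.75 m n p" for S R
      using ALG_result[OF that] le by simp
    then show ?thesis using ALG_nonempty by blast
  qed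
  then show ?thesis unfolding competitive_def migrations_at_most_def by fast
qed

end
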